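(* Let $k\ge 2$. The group $G_k$ (which is isomorphic to a Sylow 2-subgroup of $A_{2^k}$) has a generating set of least cardinality consisting of exactly $k$ elements; that is, the minimal number of generators of $G_k$ is $k$.
   Context: $X^{[k]}$ is the rooted binary tree with levels $X^0,\ldots,X^k$, where level $X^j$ has $2^j$ vertices and each vertex of level $<k$ has two children. $\mathrm{Aut}\,X^{[k]}$ is the group of automorphisms of this rooted tree, and $G_k$ is the subgroup of all automorphisms that act on the $2^k$ vertices of $X^k$ by even permutations. *)

theory Defs
  imports
    "HOL-Algebra.Algebra"
    "HOL-Algebra.Sym_Groups"
    "HOL-Algebra.Bij"
    "HOL-Combinatorics.Permutations"
    "HOL-Computational_Algebra.Primes"
begin

text \<open>
  A vertex is the word of left/right choices leading to it from the root \<open>[]\<close>;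
  the children of \<open>v\<close> are \<open>v @ [False]\<close> and \<open>v @ [True]\<close>.
\<close>

type_synonym vertex = "bool list"

definition tree_level :: "nat \<Rightarrow> vertex set" where
  "tree_level j = {v. length v = j}"

definition tree_verts :: "nat \<Rightarrow> vertex set" where
  "tree_verts k = (\<Union>j\<le>k. tree_level j)"

definition tree_adj :: "vertex \<Rightarrow> vertex \<Rightarrow> bool" where
  "tree_adj u v \<longleftrightarrow> (\<exists>b. v = u @ [b]) \<or> (\<exists>b. u = v @ [b])"

definition tree_auts :: "nat \<Rightarrow> (vertex \<Rightarrow> vertex) set" where
  "tree_auts k =
    {f \<in> Bij (tree_verts k). f [] = [] \<and>
       (\<forall>u\<in>tree_verts k. \<forall>v\<in>tree_verts k. tree_adj (f u) (f v) \<longleftrightarrow> tree_adj u v)}"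

definition Aut_tree :: "nat \<Rightarrow> (vertex \<Rightarrow> vertex) monoid" where
  "Aut_tree k = (BijGroup (tree_verts k))\<lparr>carrier := tree_auts k\<rparr>"

text \<open>
  \<^const>\<open>evenperm\<close> is meant for permutations of the whole type, so the action on the
  last level is extended by the identity.
\<close>

definition G_even :: "nat \<Rightarrow> (vertex \<Rightarrow> vertex) monoid" where
  "G_even k = (Aut_tree k)
     \<lparr>carrier := {f \<in> carrier (Aut_tree k). evenperm (restrict_id f (tree_level k))}\<rparr>"

definition sylow_subgroup :: "nat \<Rightarrow> ('a, 'b) monoid_scheme \<Rightarrow> 'a set \<Rightarrow> bool" where
  "sylow_subgroup p G P \<longleftrightarrow> subgroup P G \<and> card P = p ^ multiplicity p (order G)"

definition generating_set :: "('a, 'b) monoid_scheme \<Rightarrow> 'a set \<Rightarrow> bool" where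
  "generating_set G S \<longleftrightarrow> S \<subseteq> carrier G \<and> generate G S = carrier G"

text \<open>Only meaningful for finitely generated \<open>G\<close>.\<close>

definition min_num_generators :: "('a, 'b) monoid_scheme \<Rightarrow> nat" where
  "min_num_generators G = (LEAST n. \<exists>S. finite S \<and> card S = n \<and> generating_set G S)"

end

theory Submission
  imports Defs
begin

text \<open>
  An automorphism is encoded by its set of active vertices, those at which it swaps the two
  children; it is even on level \<open>k\<close> iff the number of active vertices on level \<open>k - 1\<close> is even.

  Upper bound: take one automorphism with a single active vertex for each level \<open>j < k - 1\<close>, and
  one with two active vertices on level \<open>k - 1\<close>, one in each half of the tree. Conjugation moves
  active vertices around, so the former generate all automorphisms inactive on level \<open>k - 1\<close>;
  these move the two vertices independently, which yields all even subsets of level \<open>k - 1\<close>.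

  Lower bound: the parities of the active vertices on the levels \<open>j < k - 1\<close>, together with the
  parity in the left half of level \<open>k - 1\<close>, give a surjection of the group onto \<open>(\<int>/2)\<^sup>k\<close>.

  Sylow property: both orders have the 2-part \<open>2 ^ (2 ^ k - 2)\<close>.
\<close>

section \<open>Automorphisms and their sets of active vertices\<close>

text \<open>Activity is read along the original word, not along its image: the tail is treated by
  the section of \<open>P\<close> at the child \<open>b\<close>, taken before the first letter is
  flipped.\<close>

primrec act :: "vertex set \<Rightarrow> vertex \<Rightarrow> vertex" where
  "act P [] = []"
| "act P (b # v) = (b \<noteq> ([] \<in> P)) # act {u. b # u \<in> P} v"

text \<open>The cocycle formula for composition with \<open>Q\<close> applied first: a swap made by
  \<open>Q\<close> at \<open>v\<close> and one made by \<open>P\<close> at \<open>act Q v\<close>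
  cancel.\<close>

definition act_mult :: "vertex set \<Rightarrow> vertex set \<Rightarrow> vertex set" where
  "act_mult P Q = sym_diff Q (act Q -` P)"

text \<open>Moves the recursion to the last letter, so that inductions can run from a vertex to its
  children.\<close>

lemma act_snoc: "act P (u @ [b]) = act P u @ [b \<noteq> (u \<in> P)]"
  by (induction u arbitrary: P) auto

lemma length_act [simp]: "length (act P v) = length v"
  by (induction v arbitrary: P) auto

lemma act_act: "act P (act Q v) = act (act_mult P Q) v"
  by (induction v rule: rev_induct) (auto simp: act_snoc act_mult_def)

lemma act_empty [simp]: "act {} v = v"
  by (induction v) auto

lemma act_cong:
  assumes "\<And>u. length u < length v \<Longrightarrow> u \<in> P \<longleftrightarrow> u \<in> Q"
  shows "act P v = act Q v"
  using assms by (induction v rule: rev_induct) (auto simp: act_snoc)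

lemma act_eq_iff [simp]: "act P u = act P v \<longleftrightarrow> u = v"
proof
  show "u = v" if "act P u = act P v"
    using that
  proof (induction u arbitrary: v rule: rev_induct)
    case Nil
    then show ?case by (metis length_act length_0_conv act.simps(1))
  next
    case (snoc b u)
    then obtain v' c where "v = v' @ [c]"
      by (metis append_is_Nil_conv length_0_conv length_act not_Cons_self2 rev_exhaust)
    with snoc show ?case by (auto simp: act_snoc)
  qed
qed simp

lemma inj_act: "inj_on (act P) A"
  by (auto simp: inj_on_def)

lemma tree_level_eq: "tree_level n = {v. set v \<subseteq> UNIV \<and> length v = n}"
  by (simp add: tree_level_def)

lemma finite_tree_level [simp]: "finite (tree_level n)"
  unfolding tree_level_eq by (rule finite_lists_length_eq) simp

lemmas finite_length_eq [simp] = finite_tree_level[unfolded tree_level_def]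

lemma card_tree_level: "card (tree_level n) = 2 ^ n"
  unfolding tree_level_eq by (subst card_lists_length_eq) simp_all

lemma bij_betw_act_level: "bij_betw (act P) (tree_level n) (tree_level n)"
  unfolding bij_betw_def
  by (intro conjI inj_act endo_inj_surj) (auto simp: tree_level_def)

lemma surj_act: "surj (act P)"
proof (rule surjI)
  fix v
  have "\<exists>u. act P u = v"
    using bij_betw_imp_surj_on[OF bij_betw_act_level[of P "length v"]]
    by (auto simp: tree_level_def image_iff set_eq_iff) metis
  then show "act P (SOME u. act P u = v) = v" by (rule someI_ex)
qed

lemma card_act_vimage: "card (act Q -` P) = card P"
  by (rule card_vimage_inj) (auto simp: inj_act surj_act)

lemma even_card_sym_diff:
  assumes "finite A" "finite B"
  shows "even (card (sym_diff A B)) \<longleftrightarrow> (even (card A) \<longleftrightarrow> even (card B))"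
proof -
  have "card A = card (A - B) + card (A \<inter> B)" "card B = card (B - A) + card (A \<inter> B)"
    using assms card_Diff_subset_Int card_Int_Diff by (metis Int_commute add.commute)+
  moreover have "card (sym_diff A B) = card (A - B) + card (B - A)"
    by (rule card_Un_disjoint) (use assms in auto)
  ultimately show ?thesis by presburger
qed

abbreviation upper :: "nat \<Rightarrow> vertex set" where
  "upper n \<equiv> {v. length v < n}"

lemma finite_upper [simp]: "finite (upper n)"
proof -
  have "upper n = (\<Union>j<n. tree_level j)" by (auto simp: tree_level_def)
  then show ?thesis by simp
qed

lemma card_upper: "card (upper n) = 2 ^ n - 1"
proof (induction n)
  case (Suc n)
  have "upper (Suc n) = upper n \<union> tree_level n" by (auto simp: tree_level_def)
  then have "card (upper (Suc n)) = card (upper n) + card (tree_level n)"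
    by (simp only:) (rule card_Un_disjoint, auto simp: tree_level_def[of n])
  with Suc show ?case by (simp add: card_tree_level)
qed simp

lemma tree_verts_eq_upper: "tree_verts k = upper (Suc k)"
  by (auto simp: tree_verts_def tree_level_def)

lemma act_mult_subset_upper:
  "P \<subseteq> upper n \<Longrightarrow> Q \<subseteq> upper n \<Longrightarrow> act_mult P Q \<subseteq> upper n"
  by (auto simp: act_mult_def subset_iff)

text \<open>Bijectivity of \<open>act Q\<close> preserves cardinality, and symmetric difference is
  addition modulo 2. Distinct \<open>A\<close> and \<open>B\<close> are allowed because a swap at
  the root exchanges the halves of a level.\<close>

lemma even_card_act_mult:
  assumes "finite A" "act Q -` A = B"
  shows "even (card (act_mult P Q \<inter> B)) \<longleftrightarrow> (even (card (P \<inter> A)) \<longleftrightarrow> even (card (Q \<inter> B)))"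
proof -
  have fin: "finite B"
    using assms finite_vimageI[OF assms(1) inj_act[of Q UNIV]] by blast
  have "act_mult P Q \<inter> B = sym_diff (Q \<inter> B) (act Q -` (P \<inter> A))"
    using assms(2) by (auto simp: act_mult_def)
  moreover have "finite (act Q -` (P \<inter> A))"
    using assms(1) by (intro finite_vimageI inj_act) simp
  ultimately show ?thesis
    using even_card_sym_diff[of "Q \<inter> B" "act Q -` (P \<inter> A)"] fin card_act_vimage[of Q "P \<inter> A"]
    by auto
qed

lemma act_vimage_level: "act Q -` tree_level n = tree_level n"
  by (auto simp: tree_level_def)

text \<open>Lets a product of single swaps be built by induction on the set of active
  vertices.\<close>

lemma insert_eq_act_mult: "v \<notin> Q \<Longrightarrow> insert v Q = act_mult {act Q v} Q"
  by (auto simp: act_mult_def)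

section \<open>Tree automorphisms correspond to subsets of \<open>upper k\<close>\<close>

definition aut :: "nat \<Rightarrow> vertex set \<Rightarrow> vertex \<Rightarrow> vertex" where
  "aut k P = restrict (act P) (tree_verts k)"

lemma aut_in_Bij: "aut k P \<in> Bij (tree_verts k)"
proof -
  have "bij_betw (act P) (tree_verts k) (tree_verts k)"
    unfolding bij_betw_def
    by (intro conjI inj_act endo_inj_surj) (auto simp: tree_verts_eq_upper)
  then show ?thesis by (simp add: aut_def Bij_def)
qed

lemma mult_aut: "aut k P \<otimes>\<^bsub>BijGroup (tree_verts k)\<^esub> aut k Q = aut k (act_mult P Q)"
  by (simp add: BijGroup_def aut_in_Bij)
    (auto simp: aut_def compose_def act_act tree_verts_eq_upper)

lemma inj_on_aut: "inj_on (aut k) (Pow (upper k))"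
proof (rule inj_onI, rule Set.set_eqI)
  fix P Q u assume *: "P \<in> Pow (upper k)" "Q \<in> Pow (upper k)" "aut k P = aut k Q"
  show "u \<in> P \<longleftrightarrow> u \<in> Q"
  proof (cases "length u < k")
    case True
    then have "act P (u @ [False]) = act Q (u @ [False])"
      using fun_cong[OF *(3), of "u @ [False]"] by (simp add: aut_def tree_verts_eq_upper)
    then show ?thesis by (auto simp: act_snoc)
  qed (use * in auto)
qed

lemma aut_in_tree_auts: "aut k P \<in> tree_auts k"
proof -
  have "tree_adj (act P u) (act P v) \<longleftrightarrow> tree_adj u v" for u v
  proof -
    have "(\<exists>b. act P v = act P u @ [b]) \<longleftrightarrow> (\<exists>b. v = u @ [b])" for u v
    proof
      assume "\<exists>b. act P v = act P u @ [b]"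
      then obtain b where b: "act P v = act P u @ [b]" by blast
      then have "v \<noteq> []" by auto
      then obtain v' c where "v = v' @ [c]" by (meson rev_exhaust)
      with b show "\<exists>b. v = u @ [b]" by (auto simp: act_snoc)
    qed (auto simp: act_snoc)
    then show ?thesis by (auto simp: tree_adj_def)
  qed
  then show ?thesis
    using aut_in_Bij[of k P] by (auto simp: tree_auts_def aut_def tree_verts_eq_upper)
qed

text \<open>An automorphism sends children to children, by induction from the root; its active
  vertices are then read off from the images of the \<open>False\<close> children.\<close>

lemma tree_auts_eq: "tree_auts k = aut k ` Pow (upper k)"
proof (intro equalityI subsetI)
  fix f assume f: "f \<in> tree_auts k"
  have inj: "inj_on f (tree_verts k)" and root: "f [] = []" and ext: "f \<in> extensional (tree_verts k)"
    using f by (auto simp: tree_auts_def Bij_def bij_betw_def)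
  have adj: "tree_adj (f u) (f (u @ [b]))" if "length u < k" for u b
    using f that by (auto simp: tree_auts_def tree_verts_eq_upper tree_adj_def)
  have child: "length u < k \<Longrightarrow> \<exists>c. f (u @ [b]) = f u @ [c]" for u b
  proof (induction u arbitrary: b rule: rev_induct)
    case Nil
    then show ?case using adj[of "[]" b] root by (auto simp: tree_adj_def)
  next
    case (snoc b' u)
    then obtain c' where c': "f (u @ [b']) = f u @ [c']" by auto
    \<comment> \<open>The neighbours of \<open>f (u @ [b'])\<close> are its children and its parent
      \<open>f u\<close>; injectivity rules out the parent.\<close>
    have "f (u @ [b', b]) \<noteq> f u"
      using inj_onD[OF inj, of "u @ [b', b]" u] snoc.prems by (auto simp: tree_verts_eq_upper)
    then show ?case
      using adj[of "u @ [b']" b] snoc.prems c' by (auto simp: tree_adj_def)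
  qed
  define P where "P = {u. length u < k \<and> f (u @ [False]) = f u @ [True]}"
  have "f v = act P v" if "length v \<le> k" for v
    using that
  proof (induction v rule: rev_induct)
    case (snoc b u)
    then obtain c d where cd: "f (u @ [False]) = f u @ [c]" "f (u @ [True]) = f u @ [d]"
      using child[of u] by fastforce
    moreover have "c \<noteq> d"
      using cd inj_onD[OF inj, of "u @ [False]" "u @ [True]"] snoc.prems
      by (auto simp: tree_verts_eq_upper)
    ultimately show ?case using snoc by (cases b) (auto simp: act_snoc P_def)
  qed (simp add: root)
  then have "f = aut k P"
    using ext by (auto simp: aut_def fun_eq_iff tree_verts_eq_upper extensional_def)
  moreover have "P \<in> Pow (upper k)" by (auto simp: P_def)
  ultimately show "f \<in> aut k ` Pow (upper k)" by blast
qed (auto simp: aut_in_tree_auts)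

section \<open>Parity of the action on a level\<close>

abbreviation level_perm :: "nat \<Rightarrow> vertex set \<Rightarrow> vertex \<Rightarrow> vertex" where
  "level_perm k P \<equiv> restrict_id (act P) (tree_level k)"

lemma level_perm_permutes: "level_perm k P permutes tree_level k"
  by (rule permutes_restrict_id) (rule bij_betw_act_level)

lemma level_perm_permutation: "permutation (level_perm k P)"
  unfolding permutation_permutes using finite_tree_level level_perm_permutes by blast

lemma level_perm_act_mult: "level_perm k (act_mult P Q) = level_perm k P \<circ> level_perm k Q"
  by (auto simp: fun_eq_iff restrict_id_def act_act tree_level_def)

lemma evenperm_conj:
  assumes "permutation p" "permutation t" "t \<circ> t = id"
  shows "evenperm (t \<circ> p \<circ> t) \<longleftrightarrow> evenperm p"
  using assms by (auto simp: evenperm_comp permutation_compose)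

lemma act_singleton_other:
  assumes "\<And>b w. v \<noteq> u @ b # w"
  shows "act {u} v = v"
  using assms
proof (induction v rule: rev_induct)
  case (snoc c v)
  have "v \<noteq> u" using snoc.prems[of c "[]"] by auto
  moreover have "v \<noteq> u @ b # w" for b w using snoc.prems[of b "w @ [c]"] by auto
  ultimately show ?case using snoc.IH by (simp add: act_snoc)
qed simp

text \<open>
  For \<open>u\<close> above the second last level, the permutation of the leaves below \<open>u\<close> splits into the
  parts on leaves ending in \<open>False\<close> and in \<open>True\<close>, which are conjugate under the map flipping
  the last letter.
\<close>
lemma evenperm_level_perm_singleton:
  assumes "length u < k"
  shows "evenperm (level_perm k {u}) \<longleftrightarrow> Suc (length u) < k"
proof (cases "Suc (length u) = k")
  case True
  have "level_perm k {u} v = transpose (u @ [False]) (u @ [True]) v" for v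
  proof (cases "\<exists>b. v = u @ [b]")
    case True
    with \<open>Suc (length u) = k\<close> show ?thesis
      by (auto simp: tree_level_def act_snoc transpose_def act_singleton_other)
  next
    case False
    have "act {u} v = v" if "length v = k"
    proof (rule act_singleton_other)
      show "v \<noteq> u @ b # w" for b w
      proof
        assume "v = u @ b # w"
        moreover from this have "w = []" using that \<open>Suc (length u) = k\<close> by auto
        ultimately show False using \<open>\<nexists>b. v = u @ [b]\<close> by blast
      qed
    qed
    with False show ?thesis
      by (auto simp: restrict_id_def tree_level_def transpose_def)
  qed
  then have "level_perm k {u} = transpose (u @ [False]) (u @ [True])" by blast
  with True show ?thesis by (simp add: evenperm_swap)
next
  case False
  with assms have lt: "Suc (length u) < k" by simp
  define t where "t = restrict_id (\<lambda>v. butlast v @ [\<not> last v]) (tree_level k)"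
  define p where "p c = restrict_id (act {u}) {v \<in> tree_level k. last v = c}" for c
  \<comment> \<open>The parent of a leaf lies strictly deeper than \<open>u\<close>, so it is
    inactive and the last letter survives.\<close>
  have last_act: "last (act {u} v) = last v" if "length v = k" for v
  proof -
    from that lt obtain v' c where v: "v = v' @ [c]"
      by (metis length_0_conv not_less_zero rev_exhaust)
    with that lt have "v' \<noteq> u" by auto
    with v show ?thesis by (simp add: act_snoc)
  qed
  have p_perm: "permutation (p c)" for c
  proof -
    have "bij_betw (act {u}) {v \<in> tree_level k. last v = c} {v \<in> tree_level k. last v = c}"
      unfolding bij_betw_def
      by (intro conjI inj_act endo_inj_surj) (auto simp: tree_level_def last_act)
    then have "p c permutes {v \<in> tree_level k. last v = c}"
      unfolding p_def by (rule permutes_restrict_id)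
    moreover have "finite {v \<in> tree_level k. last v = c}" by simp
    ultimately show ?thesis unfolding permutation_permutes by blast
  qed
  have k0: "k \<noteq> 0" using lt by simp
  have tt: "t \<circ> t = id"
    using k0 by (auto simp: t_def restrict_id_def fun_eq_iff tree_level_def)
  have "permutation t"
  proof (rule permutation_lemma[of "tree_level k"])
    show "bij t" using tt by (intro o_bij)
  qed (auto simp: t_def)
  moreover have "p True = t \<circ> p False \<circ> t"
  proof
    fix v
    show "p True v = (t \<circ> p False \<circ> t) v"
    proof (cases "length v = k")
      case True
      then obtain v' c where v: "v = v' @ [c]" using k0 by (metis length_0_conv rev_exhaust)
      with True lt have "v' \<noteq> u" by auto
      with v True show ?thesis
        by (auto simp: p_def t_def restrict_id_def tree_level_def act_snoc)
    qed (simp add: p_def t_def restrict_id_def tree_level_def)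
  qed
  ultimately have "evenperm (p True) \<longleftrightarrow> evenperm (p False)"
    using evenperm_conj p_perm tt by metis
  moreover have "level_perm k {u} = p True \<circ> p False"
    by (auto simp: p_def restrict_id_def tree_level_def fun_eq_iff last_act)
  ultimately show ?thesis using lt p_perm by (simp add: evenperm_comp)
qed

text \<open>Active vertices are added one at a time. Each contributes a single swap at
  \<open>act Q v\<close>, on the same level as \<open>v\<close>, and this is odd exactly on level
  \<open>n\<close>.\<close>

lemma evenperm_level_perm:
  assumes "P \<subseteq> upper (Suc n)"
  shows "evenperm (level_perm (Suc n) P) \<longleftrightarrow> even (card (P \<inter> tree_level n))"
proof -
  have "finite P" using assms finite_upper finite_subset by blast
  then show ?thesis using assms
  proof (induction P)
    case empty
    have "level_perm (Suc n) {} = id" by (auto simp: restrict_id_def)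
    then show ?case by simp
  next
    case (insert v Q)
    have "level_perm (Suc n) (insert v Q) = level_perm (Suc n) {act Q v} \<circ> level_perm (Suc n) Q"
      unfolding insert_eq_act_mult[OF insert.hyps(2)] by (rule level_perm_act_mult)
    then have "evenperm (level_perm (Suc n) (insert v Q)) \<longleftrightarrow>
        (length v < n \<longleftrightarrow> even (card (Q \<inter> tree_level n)))"
      using insert
      by (simp add: evenperm_comp level_perm_permutation evenperm_level_perm_singleton)
    with insert show ?case
      by (cases "length v = n") (auto simp: tree_level_def)
  qed
qed

section \<open>The group \<open>G_even k\<close> in terms of active vertices\<close>

definition even_sets :: "nat \<Rightarrow> vertex set set" where
  "even_sets k = {P. P \<subseteq> upper k \<and> even (card (P \<inter> tree_level (k - 1)))}"

lemma restrict_id_aut: "restrict_id (aut k P) (tree_level k) = level_perm k P"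
  by (auto simp: aut_def restrict_id_def tree_verts_eq_upper tree_level_def)

lemma carrier_G_even:
  assumes "k > 0"
  shows "carrier (G_even k) = aut k ` even_sets k"
proof -
  obtain n where n: "k = Suc n" using assms gr0_implies_Suc by blast
  have "carrier (G_even k) = aut k ` {P \<in> Pow (upper k). evenperm (level_perm k P)}"
    unfolding G_even_def Aut_tree_def
    by (auto simp: tree_auts_eq restrict_id_aut)
  also have "{P \<in> Pow (upper k). evenperm (level_perm k P)} = even_sets k"
    using evenperm_level_perm[of _ n] by (auto simp: even_sets_def n)
  finally show ?thesis .
qed

lemma even_sets_act_mult: "P \<in> even_sets k \<Longrightarrow> Q \<in> even_sets k \<Longrightarrow> act_mult P Q \<in> even_sets k"
  using act_mult_subset_upper[of P k Q]
    even_card_act_mult[OF finite_tree_level act_vimage_level, of P Q "k - 1"]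
  by (auto simp: even_sets_def)

lemma mult_G_even: "monoid.mult (G_even k) = monoid.mult (BijGroup (tree_verts k))"
  by (simp add: G_even_def Aut_tree_def)

lemma one_G_even: "\<one>\<^bsub>G_even k\<^esub> = aut k {}"
  by (auto simp: G_even_def Aut_tree_def BijGroup_def aut_def)

lemma aut_mult_G_even: "aut k P \<otimes>\<^bsub>G_even k\<^esub> aut k Q = aut k (act_mult P Q)"
  by (simp add: mult_G_even mult_aut)

text \<open>The inverse undoes each swap at the place to which the active vertex has moved.\<close>

lemma act_mult_image_self: "act_mult (act P ` P) P = {}"
  by (simp add: act_mult_def inj_vimage_image_eq inj_act)

lemma even_sets_inverse:
  assumes "P \<in> even_sets k"
  shows "act P ` P \<in> even_sets k"
proof -
  have "act P ` P \<inter> tree_level (k - 1) = act P ` (P \<inter> tree_level (k - 1))"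
    by (auto simp: tree_level_def)
  with assms show ?thesis by (auto simp: even_sets_def card_image inj_act)
qed

lemma even_sets_act_mult_cancel:
  assumes "act_mult P Q \<in> even_sets k" "Q \<in> even_sets k"
  shows "P \<in> even_sets k"
proof -
  have "P \<subseteq> upper k"
  proof
    fix v assume "v \<in> P"
    obtain u where u: "v = act Q u" using surj_act by (metis surjD)
    with \<open>v \<in> P\<close> have "u \<in> Q \<or> u \<in> act_mult P Q" by (auto simp: act_mult_def)
    with assms u show "v \<in> upper k" by (auto simp: even_sets_def)
  qed
  then show ?thesis
    using assms even_card_act_mult[OF finite_tree_level act_vimage_level, of P Q "k - 1"]
    by (auto simp: even_sets_def)
qed

lemma empty_in_even_sets: "{} \<in> even_sets k"
  by (simp add: even_sets_def)

lemma group_G_even: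
  assumes "k > 0"
  shows "group (G_even k)"
proof (rule groupI)
  fix x assume "x \<in> carrier (G_even k)"
  then obtain P where "x = aut k P" "P \<in> even_sets k" using carrier_G_even[OF assms] by blast
  then show "\<exists>y\<in>carrier (G_even k). y \<otimes>\<^bsub>G_even k\<^esub> x = \<one>\<^bsub>G_even k\<^esub>"
    using even_sets_inverse
    by (auto simp: carrier_G_even assms aut_mult_G_even one_G_even act_mult_image_self
        intro!: bexI[of _ "act P ` P"])
  show "\<one>\<^bsub>G_even k\<^esub> \<otimes>\<^bsub>G_even k\<^esub> x = x"
    using \<open>x = aut k P\<close> by (simp add: one_G_even aut_mult_G_even) (simp add: act_mult_def)
next
  fix x y z
  assume "x \<in> carrier (G_even k)" "y \<in> carrier (G_even k)" "z \<in> carrier (G_even k)"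
  then obtain P Q R where *: "x = aut k P" "y = aut k Q" "z = aut k R"
    using carrier_G_even[OF assms] by blast
  show "x \<otimes>\<^bsub>G_even k\<^esub> y \<otimes>\<^bsub>G_even k\<^esub> z = x \<otimes>\<^bsub>G_even k\<^esub> (y \<otimes>\<^bsub>G_even k\<^esub> z)"
  proof -
    have "act_mult (act_mult P Q) R = act_mult P (act_mult Q R)"
      by (auto simp: act_mult_def act_act[unfolded act_mult_def])
    then show ?thesis by (simp add: * aut_mult_G_even)
  qed
qed (auto simp: carrier_G_even assms aut_mult_G_even one_G_even even_sets_act_mult empty_in_even_sets)

section \<open>Generation\<close>

text \<open>Transitivity on a level, using only active vertices above that level. The word is
  corrected letter by letter from the root.\<close>

lemma ex_act_eq:
  assumes "length v = length w"
  shows "\<exists>Q\<subseteq>upper (length w). act Q v = w"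
  using assms
proof (induction w arbitrary: v rule: rev_induct)
  case (snoc b w)
  then obtain v' a where v: "v = v' @ [a]" by (metis length_0_conv rev_exhaust snoc_eq_iff_butlast)
  with snoc obtain Q where Q: "Q \<subseteq> upper (length w)" "act Q v' = w" by auto
  \<comment> \<open>Since \<open>v'\<close> is too long to lie in \<open>Q\<close>, inserting it
    flips the last letter and leaves the image of \<open>v'\<close> unchanged.\<close>
  define Q' where "Q' = (if a = b then Q else insert v' Q)"
  have "length v' = length w" using snoc.prems v by simp
  then have "act Q' v' = act Q v'" "v' \<in> Q' \<longleftrightarrow> a \<noteq> b"
    using Q(1) by (auto simp: Q'_def intro!: act_cong)
  then have "act Q' v = w @ [b]" by (auto simp: v act_snoc Q)
  moreover have "Q' \<subseteq> upper (length (w @ [b]))"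
    using Q(1) \<open>length v' = length w\<close> by (auto simp: Q'_def)
  ultimately show ?case by blast
qed simp

text \<open>Stands for a subgroup, written as a family of active sets. Right cancellation takes the
  place of inverses. It is later instantiated with the even sets whose automorphisms are
  generated.\<close>

locale act_closed =
  fixes H :: "vertex set set"
  assumes empty: "{} \<in> H"
    and mult: "P \<in> H \<Longrightarrow> Q \<in> H \<Longrightarrow> act_mult P Q \<in> H"
    and cancel: "act_mult P Q \<in> H \<Longrightarrow> Q \<in> H \<Longrightarrow> P \<in> H"
begin

lemma image_in:
  assumes "B \<subseteq> tree_level n" "Q \<subseteq> upper (Suc n)" "Q \<in> H" "B \<in> H"
  shows "act Q ` B \<in> H"
proof -
  have "act B v = act {} v" if "length v \<le> n" for v
    using assms(1) that by (intro act_cong) (auto simp: tree_level_def)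
  then have "act B -` Q = Q"
    using assms(2) by (force simp: less_Suc_eq_le)
  then have "act_mult (act Q ` B) Q = act_mult Q B"
    by (auto simp: act_mult_def inj_vimage_image_eq inj_act)
  then show ?thesis using cancel mult assms by metis
qed

text \<open>\<open>P\<close> is its part above level \<open>n\<close> followed by its level
  \<open>n\<close> part, the latter carried along by the former.\<close>

lemma level_split:
  assumes "P \<subseteq> upper (Suc n)" "P \<inter> tree_level n \<in> H" "P \<inter> upper n \<in> H"
  shows "P \<in> H"
proof -
  have "act_mult (act (P \<inter> upper n) ` (P \<inter> tree_level n)) (P \<inter> upper n) = P"
    using assms(1) by (auto simp: act_mult_def tree_level_def less_Suc_eq inj_vimage_image_eq inj_act)
  moreover have "act (P \<inter> upper n) ` (P \<inter> tree_level n) \<in> H"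
    using assms by (intro image_in) auto
  ultimately show ?thesis using mult assms(3) by metis
qed

lemma sym_diff_in:
  assumes "A \<subseteq> tree_level n" "B \<subseteq> tree_level n" "A \<in> H" "B \<in> H"
  shows "sym_diff A B \<in> H"
proof -
  have "act B v = act {} v" if "length v \<le> n" for v
    using assms(2) that by (intro act_cong) (auto simp: tree_level_def)
  then have "act B -` A = A"
    using assms(1) by (force simp: tree_level_def)
  then have "act_mult A B = sym_diff B A" by (simp add: act_mult_def)
  then show ?thesis using mult[OF assms(3,4)] by (simp add: Un_commute)
qed

text \<open>Induction on levels: the levels above \<open>m\<close> move the one given vertex to
  every vertex of level \<open>m\<close>, so conjugation gives all singletons there, and symmetric
  differences give all subsets.\<close>

lemma upper_subset_in:
  assumes "\<And>j. j < m \<Longrightarrow> \<exists>a\<in>tree_level j. {a} \<in> H" "P \<subseteq> upper m"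
  shows "P \<in> H"
  using assms
proof (induction m arbitrary: P)
  case (Suc m)
  then have IH: "Q \<in> H" if "Q \<subseteq> upper m" for Q
    using that by (metis less_Suc_eq)
  obtain a where a: "a \<in> tree_level m" "{a} \<in> H" using Suc.prems(1) by blast
  have single: "{w} \<in> H" if w: "w \<in> tree_level m" for w
  proof -
    obtain Q where Q: "Q \<subseteq> upper m" "act Q a = w"
      using ex_act_eq[of a w] a w by (auto simp: tree_level_def)
    moreover from this have "Q \<subseteq> upper (Suc m)" by auto
    ultimately have "act Q ` {a} \<in> H" using a IH by (intro image_in[of _ m]) auto
    with Q show ?thesis by simp
  qed
  have "B \<in> H" if "finite B" "B \<subseteq> tree_level m" for B
    using that
  proof (induction B)
    case (insert x B)
    then have "sym_diff {x} B \<in> H"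
      using single by (intro sym_diff_in[of _ m]) auto
    moreover have "sym_diff {x} B = insert x B" using insert.hyps by blast
    ultimately show ?case by simp
  qed (rule empty)
  then have "P \<inter> tree_level m \<in> H" by simp
  with Suc.prems(2) show ?case by (rule level_split) (rule IH, simp)
qed (simp add: empty)

lemma even_sets_subset:
  assumes n: "n > 0" and upper: "\<And>Q. Q \<subseteq> upper n \<Longrightarrow> Q \<in> H"
    and pair: "{False # x, True # y} \<in> H" "length x = n - 1" "length y = n - 1"
  shows "even_sets (Suc n) \<subseteq> H"
proof -
  have mixed: "{False # u, True # v} \<in> H" if uv: "length u = n - 1" "length v = n - 1" for u v
  proof -
    obtain Q1 Q2 where Q: "Q1 \<subseteq> upper (n - 1)" "act Q1 x = u" "Q2 \<subseteq> upper (n - 1)" "act Q2 y = v"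
      using ex_act_eq[of x u] ex_act_eq[of y v] pair uv by auto
    \<comment> \<open>The root is inactive, and the two halves are moved independently by
      \<open>Q1\<close> and \<open>Q2\<close>.\<close>
    define Q where "Q = (#) False ` Q1 \<union> (#) True ` Q2"
    have "{w. False # w \<in> Q} = Q1" "{w. True # w \<in> Q} = Q2" "[] \<notin> Q"
      by (auto simp: Q_def)
    then have "act Q ` {False # x, True # y} = {False # u, True # v}"
      using Q by simp
    moreover have "Q \<subseteq> upper n" using Q by (auto simp: Q_def subset_iff)
    ultimately show ?thesis
      using image_in[of "{False # x, True # y}" n Q] pair n upper[of Q]
      by (auto simp: tree_level_def subset_iff less_Suc_eq)
  qed
  have two: "{u, v} \<in> H" if uv: "u \<in> tree_level n" "v \<in> tree_level n" "u \<noteq> v" for u v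
  proof -
    obtain a u' b v' where *: "u = a # u'" "v = b # v'"
      using uv n by (cases u; cases v) (auto simp: tree_level_def)
    then have len: "length u' = n - 1" "length v' = n - 1" using uv by (auto simp: tree_level_def)
    show ?thesis
    proof (cases "a = b")
      case False
      then show ?thesis using mixed[OF len] mixed[OF len(2,1)] * by (cases a) (auto simp: insert_commute)
    next
      case True
      \<comment> \<open>Two vertices of the same half are linked through a vertex of the other half,
        which cancels in the symmetric difference.\<close>
      define w where "w = (\<not> a) # u'"
      have "{u, w} \<in> H" "{v, w} \<in> H"
        using mixed[OF len] mixed[OF len(2,1)] mixed[OF len(1,1)] * True
        by (cases a; auto simp: w_def insert_commute)+
      moreover have "{u, w} \<subseteq> tree_level n" "{v, w} \<subseteq> tree_level n"
        using uv * by (auto simp: w_def tree_level_def)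
      ultimately have "sym_diff {u, w} {v, w} \<in> H" by (intro sym_diff_in)
      moreover have "sym_diff {u, w} {v, w} = {u, v}"
        using uv(3) * True by (auto simp: w_def)
      ultimately show ?thesis by simp
    qed
  qed
  \<comment> \<open>An even set is exhausted by removing two vertices at a time.\<close>
  have even: "B \<in> H" if "finite B" "even (card B)" "B \<subseteq> tree_level n" for B
    using that
  proof (induction B rule: finite_psubset_induct)
    case (psubset B)
    show ?case
    proof (cases "B = {}")
      case False
      then obtain u where u: "u \<in> B" by blast
      with psubset have "B - {u} \<noteq> {}"
        by (metis card_Suc_Diff1 card.empty odd_one One_nat_def)
      then obtain v where v: "v \<in> B" "v \<noteq> u" by blast
      have "card (B - {u, v}) = card B - 2"
        using u v psubset.hyps by (simp add: card_Diff_subset)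
      then have "B - {u, v} \<in> H"
        using psubset u by (intro psubset.IH) auto
      then have "sym_diff {u, v} (B - {u, v}) \<in> H"
        using u v psubset.prems by (intro sym_diff_in[of _ n] two) auto
      moreover have "sym_diff {u, v} (B - {u, v}) = B" using u v by auto
      ultimately show ?thesis by simp
    qed (simp add: empty)
  qed
  show ?thesis
  proof
    fix P assume "P \<in> even_sets (Suc n)"
    then show "P \<in> H"
      by (intro level_split[of P n] even upper) (auto simp: even_sets_def)
  qed
qed

end

section \<open>A generating set with at most \<open>k\<close> elements\<close>

definition generator_sets :: "nat \<Rightarrow> vertex set set" where
  "generator_sets k = insert {False # replicate (k - 2) False, True # replicate (k - 2) False}
     ((\<lambda>j. {replicate j False}) ` {..<k - 1})"

lemma finite_generator_sets: "finite (generator_sets k)"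
  by (simp add: generator_sets_def)

text \<open>The inequality suffices, since the lower bound for generating sets later forces
  equality.\<close>

lemma card_generator_sets:
  assumes "k > 0"
  shows "card (generator_sets k) \<le> k"
proof -
  have "card (generator_sets k) \<le> Suc (card ((\<lambda>j. {replicate j False}) ` {..<k - 1}))"
    unfolding generator_sets_def by (rule card_insert_le_m1) simp_all
  also have "\<dots> \<le> Suc (k - 1)" using card_image_le[of "{..<k - 1}"] by simp
  finally show ?thesis using assms by simp
qed

lemma generator_sets_subset:
  assumes "k \<ge> 2"
  shows "generator_sets k \<subseteq> even_sets k"
proof -
  have "{replicate j False} \<inter> tree_level (k - 1) = {}" if "j < k - 1" for j
    using that by (auto simp: tree_level_def)
  moreover have "{False # replicate (k - 2) False, True # replicate (k - 2) False} \<subseteq> tree_level (k - 1)"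
    using assms by (auto simp: tree_level_def)
  then have "card ({False # replicate (k - 2) False, True # replicate (k - 2) False} \<inter> tree_level (k - 1)) = 2"
    by (simp add: Int_absorb2)
  ultimately show ?thesis
    using assms by (auto simp: generator_sets_def even_sets_def)
qed

lemma generating_set_generator_sets:
  assumes k: "k \<ge> 2"
  shows "generating_set (G_even k) (aut k ` generator_sets k)"
proof -
  let ?S = "aut k ` generator_sets k"
  have k0: "k > 0" using k by simp
  interpret group "G_even k" using k0 by (rule group_G_even)
  have S: "?S \<subseteq> carrier (G_even k)"
    using generator_sets_subset[OF k] by (auto simp: carrier_G_even k0)
  interpret gen: subgroup "generate (G_even k) ?S" "G_even k"
    using S by (rule generate_is_subgroup)
  \<comment> \<open>The generated subgroup is pulled back to active sets, where the closure
    arguments apply.\<close>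
  define H where "H = {P \<in> even_sets k. aut k P \<in> generate (G_even k) ?S}"
  interpret act_closed H
  proof
    show "{} \<in> H" using gen.one_closed by (simp add: H_def empty_in_even_sets one_G_even)
    show "act_mult P Q \<in> H" if "P \<in> H" "Q \<in> H" for P Q
      using that gen.m_closed[of "aut k P" "aut k Q"]
      by (simp add: H_def even_sets_act_mult aut_mult_G_even)
    show "P \<in> H" if "act_mult P Q \<in> H" "Q \<in> H" for P Q
    proof -
      have PQ: "P \<in> even_sets k" "Q \<in> even_sets k"
        using that even_sets_act_mult_cancel by (auto simp: H_def)
      then have "aut k P \<in> carrier (G_even k)" "aut k Q \<in> carrier (G_even k)"
        by (auto simp: carrier_G_even k0)
      then have "aut k P = (aut k P \<otimes>\<^bsub>G_even k\<^esub> aut k Q) \<otimes>\<^bsub>G_even k\<^esub> inv\<^bsub>G_even k\<^esub> aut k Q"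
        by (simp add: inv_solve_right)
      then show ?thesis
        using that PQ gen.m_closed gen.m_inv_closed by (simp add: H_def aut_mult_G_even)
    qed
  qed
  have gens: "P \<in> H" if "P \<in> generator_sets k" for P
    using that generator_sets_subset[OF k] by (auto simp: H_def intro: generate.incl)
  have "Q \<in> H" if "Q \<subseteq> upper (k - 1)" for Q
  proof (rule upper_subset_in[OF _ that])
    show "\<exists>a\<in>tree_level j. {a} \<in> H" if "j < k - 1" for j
      using that by (intro bexI[of _ "replicate j False"] gens)
        (auto simp: generator_sets_def tree_level_def)
  qed
  then have "even_sets (Suc (k - 1)) \<subseteq> H"
    by (rule even_sets_subset[rotated, where x = "replicate (k - 2) False" and y = "replicate (k - 2) False"])
      (use k gens in \<open>auto simp: generator_sets_def\<close>)
  then have "even_sets k \<subseteq> H" using k by simp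
  then have "carrier (G_even k) \<subseteq> generate (G_even k) ?S"
    by (auto simp: carrier_G_even k0 H_def)
  then show ?thesis using S gen.subset by (auto simp: generating_set_def)
qed

section \<open>The lower bound\<close>

text \<open>Sets under symmetric difference form a vector space over the field with two elements,
  and \<chi> is a homomorphism into it. Its image is spanned by the values on \<open>T\<close>;
  \<open>span A\<close> is the sum of the vectors \<open>\<chi> t\<close> for \<open>t\<close> in
  \<open>A\<close>.\<close>

lemma (in group) card_image_le_of_generating_set:
  fixes \<chi> :: "'a \<Rightarrow> 'c set"
  assumes T: "finite T" "generating_set G T"
    and \<chi>: "\<And>x y. x \<in> carrier G \<Longrightarrow> y \<in> carrier G \<Longrightarrow> \<chi> (x \<otimes> y) = sym_diff (\<chi> x) (\<chi> y)"
  shows "card (\<chi> ` carrier G) \<le> 2 ^ card T"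
proof -
  define span where "span A = {j. odd (card {t \<in> A. j \<in> \<chi> t})}" for A
  have span_sym_diff: "span (sym_diff A B) = sym_diff (span A) (span B)"
    if "A \<subseteq> T" "B \<subseteq> T" for A B
  proof -
    have "odd (card {t \<in> sym_diff A B. j \<in> \<chi> t}) \<longleftrightarrow>
        odd (card {t \<in> A. j \<in> \<chi> t}) \<noteq> odd (card {t \<in> B. j \<in> \<chi> t})" for j
    proof -
      have "{t \<in> sym_diff A B. j \<in> \<chi> t} = sym_diff {t \<in> A. j \<in> \<chi> t} {t \<in> B. j \<in> \<chi> t}" by auto
      moreover have "finite {t \<in> A. j \<in> \<chi> t}" "finite {t \<in> B. j \<in> \<chi> t}"
        using that by (auto intro: finite_subset[OF _ T(1)])
      ultimately show ?thesis by (simp only: even_card_sym_diff) blast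
    qed
    then show ?thesis by (auto simp: span_def)
  qed
  have TG: "T \<subseteq> carrier G" using T(2) by (simp add: generating_set_def)
  have one: "\<chi> \<one> = {}" using \<chi>[of \<one> \<one>] by simp
  have "\<chi> g \<in> span ` Pow T" if "g \<in> generate G T" for g
    using that
  proof induction
    case one
    then show ?case by (intro image_eqI[of _ _ "{}"]) (auto simp: \<open>\<chi> \<one> = {}\<close> span_def)
  next
    case (incl h)
    have "{t \<in> {h}. j \<in> \<chi> t} = (if j \<in> \<chi> h then {h} else {})" for j by auto
    with incl show ?case by (intro image_eqI[of _ _ "{h}"]) (auto simp: span_def)
  next
    case (inv h)
    \<comment> \<open>Every vector is its own negative.\<close>
    have "\<chi> (inv h) = \<chi> h"
    proof -
      have h: "h \<in> carrier G" using inv TG by auto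
      then have "sym_diff (\<chi> (inv h)) (\<chi> h) = {}" using \<chi>[of "inv h" h] one by simp
      then show ?thesis by auto
    qed
    moreover have "{t \<in> {h}. j \<in> \<chi> t} = (if j \<in> \<chi> h then {h} else {})" for j by auto
    ultimately show ?case using inv by (intro image_eqI[of _ _ "{h}"]) (auto simp: span_def)
  next
    case (eng g h)
    then obtain A B where AB: "A \<subseteq> T" "B \<subseteq> T" "\<chi> g = span A" "\<chi> h = span B" by auto
    have "g \<in> carrier G" "h \<in> carrier G" using eng.hyps generate_in_carrier[OF TG] by auto
    then have "\<chi> (g \<otimes> h) = span (sym_diff A B)" using \<chi> AB span_sym_diff by simp
    then show ?case using AB by blast
  qed
  then have "\<chi> ` carrier G \<subseteq> span ` Pow T" using T(2) by (auto simp: generating_set_def)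
  then have "card (\<chi> ` carrier G) \<le> card (span ` Pow T)" using T(1) by (intro card_mono) auto
  also have "\<dots> \<le> card (Pow T)" using T(1) by (intro card_image_le) simp
  finally show ?thesis using T(1) by (simp add: card_Pow)
qed

definition half_level :: "bool \<Rightarrow> nat \<Rightarrow> vertex set" where
  "half_level b n = {v \<in> tree_level n. hd v = b}"

text \<open>
  Index \<open>k - 1\<close> records the parity in the left half of the last active level; on
  \<^term>\<open>even_sets k\<close> it agrees with the parity in the right half, and therefore does not
  depend on whether the two halves are swapped.
\<close>
definition parities :: "nat \<Rightarrow> vertex set \<Rightarrow> nat set" where
  "parities k P = {j. j < k - 1 \<and> odd (card (P \<inter> tree_level j))} \<union>
     (if odd (card (P \<inter> half_level False (k - 1))) then {k - 1} else {})"

lemma finite_half_level [simp]: "finite (half_level b n)"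
  by (simp add: half_level_def)

lemma even_card_half_level:
  assumes "P \<in> even_sets k"
  shows "even (card (P \<inter> half_level b (k - 1))) \<longleftrightarrow> even (card (P \<inter> half_level False (k - 1)))"
proof -
  have "P \<inter> tree_level (k - 1) = (P \<inter> half_level False (k - 1)) \<union> (P \<inter> half_level True (k - 1))"
    by (auto simp: half_level_def)
  then have "card (P \<inter> tree_level (k - 1)) =
      card (P \<inter> half_level False (k - 1)) + card (P \<inter> half_level True (k - 1))"
    by (simp only:) (rule card_Un_disjoint; auto simp: half_level_def)
  then show ?thesis using assms by (cases b) (auto simp: even_sets_def)
qed

text \<open>Only the activity of the root decides whether the halves are exchanged.\<close>

lemma act_vimage_half_level:
  assumes "n > 0"
  shows "act Q -` half_level (b \<noteq> ([] \<in> Q)) n = half_level b n"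
proof -
  have "hd (act Q v) = (hd v \<noteq> ([] \<in> Q))" if "length v = n" for v
    using that assms by (cases v) auto
  then show ?thesis by (auto simp: half_level_def tree_level_def)
qed

lemma parities_act_mult:
  assumes "k \<ge> 2" "P \<in> even_sets k"
  shows "parities k (act_mult P Q) = sym_diff (parities k P) (parities k Q)"
proof -
  have "even (card (act_mult P Q \<inter> half_level False (k - 1))) \<longleftrightarrow>
      (even (card (P \<inter> half_level False (k - 1))) \<longleftrightarrow> even (card (Q \<inter> half_level False (k - 1))))"
    using even_card_act_mult[OF finite_half_level act_vimage_half_level, of "k - 1" P Q False]
      even_card_half_level[OF assms(2), of "False \<noteq> ([] \<in> Q)"] assms(1) by auto
  moreover have "even (card (act_mult P Q \<inter> tree_level j)) \<longleftrightarrow>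
      (even (card (P \<inter> tree_level j)) \<longleftrightarrow> even (card (Q \<inter> tree_level j)))" for j
    by (rule even_card_act_mult) (simp_all add: act_vimage_level)
  ultimately show ?thesis by (auto simp: parities_def)
qed

lemma parities_surj:
  assumes "k \<ge> 2"
  shows "Pow {..<k} \<subseteq> parities k ` even_sets k"
proof
  fix J assume J: "J \<in> Pow {..<k}"
  let ?r = "replicate (k - 2) False"
  \<comment> \<open>The pair meets each half once, so it switches the last parity while keeping the
    total on level \<open>k - 1\<close> even. The other levels in \<open>J\<close> get their
    leftmost vertex.\<close>
  define B where "B = (if k - 1 \<in> J then {False # ?r, True # ?r} else {})"
  define P where "P = (\<lambda>j. replicate j False) ` (J - {k - 1}) \<union> B"
  have B: "B \<subseteq> tree_level (k - 1)" using assms by (auto simp: B_def tree_level_def)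
  have low: "P \<inter> tree_level j = (if j \<in> J then {replicate j False} else {})" if "j < k - 1" for j
    using that B by (auto simp: P_def tree_level_def)
  have top: "P \<inter> tree_level (k - 1) = B"
    using B J by (auto simp: P_def tree_level_def)
  then have "P \<inter> half_level False (k - 1) = B \<inter> half_level False (k - 1)"
    by (auto simp: half_level_def)
  also have "\<dots> = (if k - 1 \<in> J then {False # ?r} else {})"
    using B by (auto simp: B_def half_level_def)
  finally have half: "P \<inter> half_level False (k - 1) = (if k - 1 \<in> J then {False # ?r} else {})" .
  have "j \<in> parities k P \<longleftrightarrow> j \<in> J" for j
    using J unfolding parities_def half
    by (cases "j < k - 1"; cases "j = k - 1") (auto simp: low)
  then have "parities k P = J" by blast
  moreover have "P \<in> even_sets k"
    using J assms top by (auto simp: even_sets_def B_def P_def less_eq_Suc_le)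
  ultimately show "J \<in> parities k ` even_sets k" by blast
qed

lemma card_generating_set_ge:
  assumes k: "k \<ge> 2" and T: "finite T" "generating_set (G_even k) T"
  shows "k \<le> card T"
proof -
  have k0: "k > 0" using k by simp
  interpret group "G_even k" using k0 by (rule group_G_even)
  \<comment> \<open>The parities are defined on active sets, so the injective encoding is inverted
    first.\<close>
  define \<chi> where "\<chi> = parities k \<circ> inv_into (Pow (upper k)) (aut k)"
  have \<chi>_aut: "\<chi> (aut k P) = parities k P" if "P \<in> even_sets k" for P
    using that inv_into_f_f[OF inj_on_aut] by (auto simp: \<chi>_def even_sets_def)
  have "\<chi> (x \<otimes>\<^bsub>G_even k\<^esub> y) = sym_diff (\<chi> x) (\<chi> y)"
    if "x \<in> carrier (G_even k)" "y \<in> carrier (G_even k)" for x y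
    using that k by (auto simp: carrier_G_even k0 aut_mult_G_even \<chi>_aut even_sets_act_mult
        parities_act_mult)
  then have "card (\<chi> ` carrier (G_even k)) \<le> 2 ^ card T"
    by (rule card_image_le_of_generating_set[OF T])
  moreover have "Pow {..<k} \<subseteq> \<chi> ` carrier (G_even k)"
  proof -
    have "\<chi> ` carrier (G_even k) = parities k ` even_sets k"
      by (force simp: carrier_G_even k0 image_image \<chi>_aut)
    then show ?thesis using parities_surj[OF k] by simp
  qed
  moreover have "finite (\<chi> ` carrier (G_even k))"
  proof -
    have "finite (even_sets k)"
      by (rule finite_subset[of _ "Pow (upper k)"]) (auto simp: even_sets_def)
    then show ?thesis by (simp add: carrier_G_even k0)
  qed
  ultimately have "card (Pow {..<k}) \<le> 2 ^ card T"
    by (meson card_mono le_trans)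
  then have "(2::nat) ^ k \<le> 2 ^ card T" by (simp add: card_Pow)
  then show ?thesis by simp
qed

section \<open>The Sylow subgroup\<close>

text \<open>In the step from \<open>n\<close> to \<open>Suc n\<close> the new factors are
  \<open>2 * Suc n\<close> and an odd number, so the left side grows by one more than the
  multiplicity of \<open>Suc n\<close>.\<close>

lemma multiplicity_two_fact_double:
  "multiplicity 2 (fact (2 * n) :: nat) = n + multiplicity 2 (fact n :: nat)"
proof (induction n)
  case (Suc n)
  have "(fact (2 * Suc n) :: nat) = 2 * (Suc n * (Suc (2 * n) * fact (2 * n)))"
    by (simp add: algebra_simps)
  moreover have "multiplicity 2 (Suc (2 * n)) = 0" by (rule not_dvd_imp_multiplicity_0) simp
  ultimately show ?case
    using Suc by (simp add: prime_elem_multiplicity_mult_distrib del: fact_Suc mult_Suc mult_Suc_right)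
      (simp add: prime_elem_multiplicity_mult_distrib del: mult_Suc mult_Suc_right)
qed simp

lemma multiplicity_two_fact_power: "multiplicity 2 (fact (2 ^ k) :: nat) = 2 ^ k - 1"
  by (induction k) (simp_all add: multiplicity_two_fact_double)

lemma multiplicity_two_order_alt_group:
  assumes "k > 0"
  shows "multiplicity 2 (order (alt_group (2 ^ k))) = 2 ^ k - 2"
proof -
  have "(2::nat) ^ 1 \<le> 2 ^ k" using assms by (intro power_increasing) auto
  then have eq: "2 * order (alt_group (2 ^ k)) = fact (2 ^ k)"
    unfolding order_def by (intro alt_group_card_carrier) simp
  then have "order (alt_group (2 ^ k)) \<noteq> 0" by (metis fact_nonzero mult_zero_right)
  then have "multiplicity 2 (2 * order (alt_group (2 ^ k))) = Suc (multiplicity 2 (order (alt_group (2 ^ k))))"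
    by (simp add: prime_elem_multiplicity_mult_distrib)
  then show ?thesis by (simp add: eq multiplicity_two_fact_power)
qed

text \<open>Fix a vertex \<open>u\<close> of level \<open>k - 1\<close>. The rest of the set is
  arbitrary, and parity then decides whether \<open>u\<close> belongs to it; this leaves
  \<open>2 ^ k - 2\<close> free vertices.\<close>

lemma card_even_sets:
  assumes "k > 0"
  shows "card (even_sets k) = 2 ^ (2 ^ k - 2)"
proof -
  define u where "u = replicate (k - 1) False"
  define L where "L = tree_level (k - 1)"
  have u: "u \<in> upper k" "u \<in> L" using assms by (auto simp: u_def L_def tree_level_def)
  have fin: "finite L" by (simp add: L_def)
  have toggle: "even (card (insert u R \<inter> L)) \<longleftrightarrow> odd (card (R \<inter> L))" if "u \<notin> R" for R
    using that u fin by simp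
  have "bij_betw (\<lambda>P. P - {u}) (even_sets k) (Pow (upper k - {u}))"
  proof (rule bij_betw_byWitness[where f' = "\<lambda>R. if even (card (R \<inter> L)) then R else insert u R"])
    show "\<forall>P\<in>even_sets k. (if even (card ((P - {u}) \<inter> L)) then P - {u} else insert u (P - {u})) = P"
    proof
      fix P assume P: "P \<in> even_sets k"
      show "(if even (card ((P - {u}) \<inter> L)) then P - {u} else insert u (P - {u})) = P"
        using P toggle[of "P - {u}"]
        by (cases "u \<in> P") (auto simp: even_sets_def L_def insert_absorb)
    qed
    show "\<forall>R\<in>Pow (upper k - {u}).
        (if even (card (R \<inter> L)) then R else insert u R) - {u} = R"
      by auto
    show "(\<lambda>R. if even (card (R \<inter> L)) then R else insert u R) ` Pow (upper k - {u})
        \<subseteq> even_sets k"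
    proof
      fix P assume "P \<in> (\<lambda>R. if even (card (R \<inter> L)) then R else insert u R) ` Pow (upper k - {u})"
      then obtain R where R: "R \<subseteq> upper k - {u}" "P = (if even (card (R \<inter> L)) then R else insert u R)"
        by blast
      then have "u \<notin> R" "P \<subseteq> upper k" using u by auto
      moreover have "even (card (P \<inter> L))" using R(2) toggle \<open>u \<notin> R\<close> by simp
      ultimately show "P \<in> even_sets k" by (simp add: even_sets_def L_def)
    qed
  qed (auto simp: even_sets_def)
  then have "card (even_sets k) = card (Pow (upper k - {u}))" by (rule bij_betw_same_card)
  also have "\<dots> = 2 ^ (2 ^ k - 1 - 1)"
    using u by (simp add: card_Pow card_upper)
  finally show ?thesis by (simp add: numeral_2_eq_2)
qed

lemma take_act: "take n (act P v) = act P (take n v)"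
proof (induction v rule: rev_induct)
  case (snoc b v)
  then show ?case by (cases "n \<le> length v") (auto simp: act_snoc)
qed simp

text \<open>Every vertex is a prefix of some leaf, and the action commutes with taking prefixes, so
  the action on leaves determines the automorphism.\<close>

lemma inj_on_level_perm: "inj_on (level_perm k) (Pow (upper k))"
proof (rule inj_onI, rule inj_onD[OF inj_on_aut[of k]])
  fix P Q assume eq: "level_perm k P = level_perm k Q"
  have "act P v = act Q v" if "length v \<le> k" for v
  proof -
    let ?w = "v @ replicate (k - length v) False"
    have "act P ?w = act Q ?w"
      using fun_cong[OF eq, of ?w] that by (simp add: tree_level_def)
    then have "take (length v) (act P ?w) = take (length v) (act Q ?w)" by simp
    then show ?thesis by (simp add: take_act)
  qed
  then show "aut k P = aut k Q" by (auto simp: aut_def tree_verts_eq_upper fun_eq_iff)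
qed

lemma G_even_iso_sylow_subgroup:
  assumes k: "k > 0"
  shows "\<exists>P. sylow_subgroup 2 (alt_group (2 ^ k)) P \<and>
    G_even k \<cong> (alt_group (2 ^ k))\<lparr>carrier := P\<rparr>"
proof -
  let ?L = "tree_level k" and ?A = "alt_group (2 ^ k)"
  have "\<exists>e. bij_betw e ?L {1..2 ^ k :: nat}"
    by (rule finite_same_card_bij) (simp_all add: card_tree_level)
  then obtain e where e: "bij_betw e ?L {1..2 ^ k :: nat}" by blast
  then have inj_e: "inj_on e ?L" by (rule bij_betw_imp_inj_on)
  \<comment> \<open>The action on leaves, transported along the numbering \<open>e\<close> to a
    permutation of \<open>{1..2 ^ k}\<close>. It is an injective homomorphism, so its image has the
    order required of a Sylow subgroup.\<close>
  define \<theta> where "\<theta> f = map_permutation ?L e (restrict_id f ?L)" for f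
  have \<theta>_aut: "\<theta> (aut k P) = map_permutation ?L e (level_perm k P)" for P
    by (simp add: \<theta>_def restrict_id_aut)
  have G: "carrier (G_even k) = aut k ` even_sets k" using k by (rule carrier_G_even)
  have even: "evenperm (level_perm k P)" if "P \<in> even_sets k" for P
    using that evenperm_level_perm[of P "k - 1"] k by (auto simp: even_sets_def)
  have "\<theta> \<in> hom (G_even k) ?A"
  proof (rule homI)
    fix x assume "x \<in> carrier (G_even k)"
    then show "\<theta> x \<in> carrier ?A"
      using even map_permutation_permutes[OF e level_perm_permutes]
      by (auto simp: G alt_group_carrier \<theta>_aut evenperm_map_permutation[OF inj_e level_perm_permutes])
  next
    fix x y assume "x \<in> carrier (G_even k)" "y \<in> carrier (G_even k)"
    then show "\<theta> (x \<otimes>\<^bsub>G_even k\<^esub> y) = \<theta> x \<otimes>\<^bsub>?A\<^esub> \<theta> y"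
      by (auto simp: G aut_mult_G_even \<theta>_aut level_perm_act_mult alt_group_mult
          map_permutation_compose'[OF inj_e level_perm_permutes])
  qed
  then interpret group_hom "G_even k" ?A \<theta>
    by (intro group_hom.intro group_hom_axioms.intro group_G_even alt_group_is_group k)
  have inj: "inj_on \<theta> (carrier (G_even k))"
  proof (rule inj_onI)
    fix x y assume xy: "x \<in> carrier (G_even k)" "y \<in> carrier (G_even k)" "\<theta> x = \<theta> y"
    then obtain P Q where PQ: "x = aut k P" "y = aut k Q" "P \<in> even_sets k" "Q \<in> even_sets k"
      by (auto simp: G)
    have "level_perm k P = level_perm k Q"
    proof -
      have "map_permutation {1..2 ^ k} (inv_into ?L e) (map_permutation ?L e (level_perm k R)) = level_perm k R" for R
        by (rule map_permutation_compose_inv[OF e level_perm_permutes]) (simp add: inj_e)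
      then show ?thesis using xy(3) PQ by (metis \<theta>_aut)
    qed
    then show "x = y" using inj_onD[OF inj_on_level_perm] PQ by (auto simp: even_sets_def)
  qed
  let ?P = "\<theta> ` carrier (G_even k)"
  have "card ?P = card (carrier (G_even k))" using inj by (rule card_image)
  also have "\<dots> = card (even_sets k)"
    unfolding G by (rule card_image) (rule inj_on_subset[OF inj_on_aut], auto simp: even_sets_def)
  finally have "sylow_subgroup 2 ?A ?P"
    using img_is_subgroup by (simp add: sylow_subgroup_def card_even_sets k multiplicity_two_order_alt_group)
  moreover have "\<theta> \<in> iso (G_even k) (?A\<lparr>carrier := ?P\<rparr>)"
    using homh inj by (auto simp: iso_def hom_def bij_betw_def)
  then have "G_even k \<cong> ?A\<lparr>carrier := ?P\<rparr>" by (auto simp: is_iso_def)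
  ultimately show ?thesis by blast
qed

theorem corollary6:
  fixes k :: nat
  assumes "k \<ge> 2"
  shows "(\<exists>P. sylow_subgroup 2 (alt_group (2 ^ k)) P \<and>
              G_even k \<cong> (alt_group (2 ^ k))\<lparr>carrier := P\<rparr>)
       \<and> (\<exists>S. finite S \<and> card S = k \<and> generating_set (G_even k) S \<and>
              (\<forall>T. finite T \<and> generating_set (G_even k) T \<longrightarrow> card S \<le> card T))
       \<and> min_num_generators (G_even k) = k"
proof -
  define S where "S = aut k ` generator_sets k"
  have gen: "generating_set (G_even k) S"
    unfolding S_def using assms by (rule generating_set_generator_sets)
  have fin: "finite S" by (simp add: S_def finite_generator_sets)
  have "card S \<le> card (generator_sets k)"
    unfolding S_def by (rule card_image_le) (rule finite_generator_sets)
  also have "\<dots> \<le> k" using assms by (intro card_generator_sets) simp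
  \<comment> \<open>The lower bound applied to \<open>S\<close> itself turns the estimate into an
    equality.\<close>
  finally have card: "card S = k"
    using card_generating_set_ge[OF assms fin gen] by simp
  have min: "k \<le> card T" if "finite T" "generating_set (G_even k) T" for T
    using assms that by (rule card_generating_set_ge)
  have "min_num_generators (G_even k) = k"
    unfolding min_num_generators_def using fin gen card min by (intro Least_equality) auto
  then show ?thesis
    using G_even_iso_sylow_subgroup[of k] assms fin gen card min by auto
qed

end
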